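(* Let $T$ be a (balanced, median-split) $k$d-tree constructed over $n$ points in $\mathbb{R}^d$. A batch of $B$ points can be deleted from $T$ in $O(B\log n)$ work and $O(\log B\log n)$ depth in the worst case.
   Context: A $k$d-tree over a point set is a binary tree in which the root represents all points; each internal node stores a splitting dimension and splitting value defining an axis-aligned hyperplane splitting its points into two parts represented by its two children; leaves hold a constant number of points. Here the tree is built by splitting at the median at each level, so it has $O(\log n)$ levels. Deleting a batch means removing the given points from the leaves and removing internal nodes whose subtrees become empty (contracting nodes left with a single child). Complexity is in the work-depth model: work is the total number of operations, depth is the length of the longest chain of sequential dependencies. *)

theory Defs
  imports Complex_Main
begin

section \<open>Median-split kd-trees\<close>

type_synonym point = "real list"

definition space_dim :: "nat \<Rightarrow> point set" where
  "space_dim d = {p. length p = d}"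

text \<open>An internal node carries its splitting dimension and its splitting value.\<close>

datatype kdtree = Leaf "point list" | Node nat real kdtree kdtree

primrec points :: "kdtree \<Rightarrow> point set" where
  "points (Leaf ps) = set ps"
| "points (Node i s l r) = points l \<union> points r"

text \<open>
  The predicate \<open>median_kdtree d b X T\<close> says that \<open>T\<close> is a possible result of
  building a kd-tree over the set \<open>X\<close> of points in dimension \<open>d\<close>, with leaf capacity \<open>b\<close>.
  Points on a splitting hyperplane belong to the right part, so that the hyperplane
  alone determines the part of every point.  A median split puts half of the points,
  rounded down or up, on the left.  The splitting dimension may be chosen freely at each
  node, and the splitting value may be any number separating the two halves
  (for instance the coordinate of the upper middle point, or the mean of the two middle ones).
\<close>

inductive median_kdtree :: "nat \<Rightarrow> nat \<Rightarrow> point set \<Rightarrow> kdtree \<Rightarrow> bool" for d b where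
  leaf: "\<lbrakk>ps \<noteq> []; distinct ps; length ps \<le> b; set ps \<subseteq> space_dim d\<rbrakk>
         \<Longrightarrow> median_kdtree d b (set ps) (Leaf ps)"
| node: "\<lbrakk>i < d;
          L = {p \<in> X. p ! i < s}; R = {p \<in> X. s \<le> p ! i};
          card L = card X div 2 \<or> card R = card X div 2;
          median_kdtree d b L l; median_kdtree d b R r\<rbrakk>
         \<Longrightarrow> median_kdtree d b X (Node i s l r)"

lemma points_median_kdtree:
  "median_kdtree d b X T \<Longrightarrow> points T = X \<and> finite X \<and> X \<noteq> {} \<and> X \<subseteq> space_dim d"
proof (induction rule: median_kdtree.induct)
  case (node i L X s R l r)
  have "X = L \<union> R" unfolding node.hyps(2,3) by auto
  with node.IH show ?case by simp
qed auto

section \<open>Deletion\<close>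

text \<open>The empty tree is represented by \<open>None\<close>.\<close>

fun join_children :: "nat \<Rightarrow> real \<Rightarrow> kdtree option \<Rightarrow> kdtree option \<Rightarrow> kdtree option" where
  "join_children i s None None = None"
| "join_children i s (Some l) None = Some l"
| "join_children i s None (Some r) = Some r"
| "join_children i s (Some l) (Some r) = Some (Node i s l r)"

primrec delete_points :: "point set \<Rightarrow> kdtree \<Rightarrow> kdtree option" where
  "delete_points D (Leaf ps) =
     (let qs = filter (\<lambda>p. p \<notin> D) ps in if qs = [] then None else Some (Leaf qs))"
| "delete_points D (Node i s l r) =
     join_children i s (delete_points D l) (delete_points D r)"

lemma points_delete_points:
  "(case delete_points D T of None \<Rightarrow> {} | Some T' \<Rightarrow> points T') = points T - D"
proof (induction T)
  case (Leaf ps)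
  show ?case by (auto simp: Let_def filter_empty_conv)
next
  case (Node i s l r)
  then show ?case
    by (cases "delete_points D l"; cases "delete_points D r") auto
qed

section \<open>The work-depth model\<close>

text \<open>
  Programs are finite lists of mutually recursive first-order functions over immutable
  data.  Every instruction has unit cost.  Parallelism is binary fork-join.  The only
  arrays a program can access are those contained in its input; there is no unit-cost bulk
  operation on arrays.
\<close>

datatype val =
    VUnit
  | VBool bool
  | VNat nat
  | VReal real
  | VPair val val
  | VArray "val list"

datatype unop = Fst | Snd | IsUnit | Half | Len

datatype binop = MkPair | Add | Sub | Less | Equal | Nth

text \<open>Variables are positions in the environment; \<open>Call f e\<close> calls the \<open>f\<close>-th function.\<close>

datatype exp =
    Var nat
  | UnitC
  | BoolC bool
  | NatC nat
  | Op1 unop exp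
  | Op2 binop exp exp
  | Cond exp exp exp
  | LetIn exp exp
  | Par exp exp
  | Call nat exp

type_synonym program = "exp list"

primrec unop_val :: "unop \<Rightarrow> val \<Rightarrow> val option" where
  "unop_val Fst v = (case v of VPair x y \<Rightarrow> Some x | _ \<Rightarrow> None)"
| "unop_val Snd v = (case v of VPair x y \<Rightarrow> Some y | _ \<Rightarrow> None)"
| "unop_val IsUnit v = Some (VBool (v = VUnit))"
| "unop_val Half v = (case v of VNat m \<Rightarrow> Some (VNat (m div 2)) | _ \<Rightarrow> None)"
| "unop_val Len v = (case v of VArray xs \<Rightarrow> Some (VNat (length xs)) | _ \<Rightarrow> None)"

primrec binop_val :: "binop \<Rightarrow> val \<Rightarrow> val \<Rightarrow> val option" where
  "binop_val MkPair u v = Some (VPair u v)"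
| "binop_val Add u v =
     (case (u, v) of (VNat m, VNat n) \<Rightarrow> Some (VNat (m + n)) | _ \<Rightarrow> None)"
| "binop_val Sub u v =
     (case (u, v) of (VNat m, VNat n) \<Rightarrow> Some (VNat (m - n)) | _ \<Rightarrow> None)"
| "binop_val Less u v =
     (case (u, v) of (VNat m, VNat n) \<Rightarrow> Some (VBool (m < n))
        | (VReal x, VReal y) \<Rightarrow> Some (VBool (x < y)) | _ \<Rightarrow> None)"
| "binop_val Equal u v =
     (case (u, v) of (VNat m, VNat n) \<Rightarrow> Some (VBool (m = n))
        | (VReal x, VReal y) \<Rightarrow> Some (VBool (x = y)) | _ \<Rightarrow> None)"
| "binop_val Nth u v =
     (case (u, v) of
        (VArray xs, VNat k) \<Rightarrow> if k < length xs then Some (xs ! k) else None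
      | _ \<Rightarrow> None)"

text \<open>
  \<open>eval P \<rho> e v w s\<close>: in environment \<open>\<rho>\<close>, the expression \<open>e\<close> terminates with value \<open>v\<close>,
  work \<open>w\<close> and depth \<open>s\<close>.  The depths of the two branches of \<open>Par\<close> are combined by their
  maximum; everything else is sequential.
\<close>

inductive eval :: "program \<Rightarrow> val list \<Rightarrow> exp \<Rightarrow> val \<Rightarrow> nat \<Rightarrow> nat \<Rightarrow> bool" for P where
  Var: "i < length \<rho> \<Longrightarrow> eval P \<rho> (Var i) (\<rho> ! i) 1 1"
| UnitC: "eval P \<rho> UnitC VUnit 1 1"
| BoolC: "eval P \<rho> (BoolC c) (VBool c) 1 1"
| NatC: "eval P \<rho> (NatC m) (VNat m) 1 1"
| Op1: "\<lbrakk>eval P \<rho> e x w s; unop_val f x = Some v\<rbrakk>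
       \<Longrightarrow> eval P \<rho> (Op1 f e) v (w + 1) (s + 1)"
| Op2: "\<lbrakk>eval P \<rho> e1 x w1 s1; eval P \<rho> e2 y w2 s2; binop_val f x y = Some v\<rbrakk>
        \<Longrightarrow> eval P \<rho> (Op2 f e1 e2) v (w1 + w2 + 1) (s1 + s2 + 1)"
| Cond: "\<lbrakk>eval P \<rho> e (VBool c) w1 s1; eval P \<rho> (if c then e1 else e2) v w2 s2\<rbrakk>
       \<Longrightarrow> eval P \<rho> (Cond e e1 e2) v (w1 + w2 + 1) (s1 + s2 + 1)"
| LetIn: "\<lbrakk>eval P \<rho> e1 x w1 s1; eval P (x # \<rho>) e2 v w2 s2\<rbrakk>
        \<Longrightarrow> eval P \<rho> (LetIn e1 e2) v (w1 + w2 + 1) (s1 + s2 + 1)"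
| Par: "\<lbrakk>eval P \<rho> e1 x w1 s1; eval P \<rho> e2 y w2 s2\<rbrakk>
        \<Longrightarrow> eval P \<rho> (Par e1 e2) (VPair x y) (w1 + w2 + 1) (max s1 s2 + 1)"
| Call: "\<lbrakk>eval P \<rho> e x w1 s1; f < length P; eval P [x] (P ! f) v w2 s2\<rbrakk>
         \<Longrightarrow> eval P \<rho> (Call f e) v (w1 + w2 + 1) (s1 + s2 + 1)"

inductive_cases eval_VarE: "eval P \<rho> (Var i) v w s"
inductive_cases eval_UnitCE: "eval P \<rho> UnitC v w s"
inductive_cases eval_BoolCE: "eval P \<rho> (BoolC c) v w s"
inductive_cases eval_NatCE: "eval P \<rho> (NatC m) v w s"
inductive_cases eval_Op1E: "eval P \<rho> (Op1 f e) v w s"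
inductive_cases eval_Op2E: "eval P \<rho> (Op2 f e1 e2) v w s"
inductive_cases eval_CondE: "eval P \<rho> (Cond e e1 e2) v w s"
inductive_cases eval_LetInE: "eval P \<rho> (LetIn e1 e2) v w s"
inductive_cases eval_ParE: "eval P \<rho> (Par e1 e2) v w s"
inductive_cases eval_CallE: "eval P \<rho> (Call f e) v w s"

lemma eval_deterministic:
  assumes "eval P \<rho> e v w s" "eval P \<rho> e v' w' s'"
  shows "v' = v \<and> w' = w \<and> s' = s"
  using assms
proof (induction arbitrary: v' w' s' rule: eval.induct)
  case (Op1 \<rho> e x w s f v)
  from Op1.prems obtain x' a c where "eval P \<rho> e x' a c"
    and *: "unop_val f x' = Some v'" "w' = a + 1" "s' = c + 1"
    by (rule eval_Op1E) simp
  from Op1.IH[OF this(1)] * Op1.hyps show ?case by simp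
next
  case (Op2 \<rho> e1 x w1 s1 e2 y w2 s2 f v)
  from Op2.prems obtain x' y' a1 c1 a2 c2
    where "eval P \<rho> e1 x' a1 c1" "eval P \<rho> e2 y' a2 c2"
    and *: "binop_val f x' y' = Some v'" "w' = a1 + a2 + 1" "s' = c1 + c2 + 1"
    by (rule eval_Op2E) simp
  from Op2.IH(1)[OF this(1)] Op2.IH(2)[OF this(2)] * Op2.hyps show ?case by simp
next
  case (Cond \<rho> e c w1 s1 e1 e2 v w2 s2)
  from Cond.prems obtain c' a1 c1 a2 c2
    where 1: "eval P \<rho> e (VBool c') a1 c1"
    and 2: "eval P \<rho> (if c' then e1 else e2) v' a2 c2"
    and *: "w' = a1 + a2 + 1" "s' = c1 + c2 + 1"
    by (rule eval_CondE) simp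
  from Cond.IH(1)[OF 1] have 3: "c' = c" "a1 = w1" "c1 = s1" by simp_all
  from Cond.IH(2)[OF 2[unfolded 3(1)]] 3 * show ?case by simp
next
  case (LetIn \<rho> e1 x w1 s1 e2 v w2 s2)
  from LetIn.prems obtain x' a1 c1 a2 c2
    where 1: "eval P \<rho> e1 x' a1 c1" and 2: "eval P (x' # \<rho>) e2 v' a2 c2"
    and *: "w' = a1 + a2 + 1" "s' = c1 + c2 + 1"
    by (rule eval_LetInE) simp
  from LetIn.IH(1)[OF 1] have 3: "x' = x" "a1 = w1" "c1 = s1" by simp_all
  from LetIn.IH(2)[OF 2[unfolded 3(1)]] 3 * show ?case by simp
next
  case (Par \<rho> e1 x w1 s1 e2 y w2 s2)
  from Par.prems obtain x' y' a1 c1 a2 c2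
    where "eval P \<rho> e1 x' a1 c1" "eval P \<rho> e2 y' a2 c2"
    and *: "v' = VPair x' y'" "w' = a1 + a2 + 1" "s' = max c1 c2 + 1"
    by (rule eval_ParE) simp
  from Par.IH(1)[OF this(1)] Par.IH(2)[OF this(2)] * show ?case by simp
next
  case (Call \<rho> e x w1 s1 f v w2 s2)
  from Call.prems obtain x' a1 c1 a2 c2
    where 1: "eval P \<rho> e x' a1 c1" and 2: "eval P [x'] (P ! f) v' a2 c2"
    and *: "w' = a1 + a2 + 1" "s' = c1 + c2 + 1"
    by (rule eval_CallE) simp
  from Call.IH(1)[OF 1] have 3: "x' = x" "a1 = w1" "c1 = s1" by simp_all
  from Call.IH(2)[OF 2[unfolded 3(1)]] 3 * show ?case by simp
next
  case (Var i \<rho>)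
  from Var.prems show ?case by (rule eval_VarE) simp
next
  case (UnitC \<rho>)
  from UnitC.prems show ?case by (rule eval_UnitCE) simp
next
  case (BoolC \<rho> c)
  from BoolC.prems show ?case by (rule eval_BoolCE) simp
next
  case (NatC \<rho> m)
  from NatC.prems show ?case by (rule eval_NatCE) simp
qed

text \<open>Execution starts in the first function of a program.\<close>

definition runs :: "program \<Rightarrow> val \<Rightarrow> val \<Rightarrow> nat \<Rightarrow> nat \<Rightarrow> bool" where
  "runs P x v w s \<longleftrightarrow> P \<noteq> [] \<and> eval P [x] (hd P) v w s"

section \<open>Representation of points, batches and trees\<close>

definition enc_point :: "point \<Rightarrow> val" where
  "enc_point p = VArray (map VReal p)"

definition enc_batch :: "point list \<Rightarrow> val" where
  "enc_batch ps = VArray (map enc_point ps)"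

text \<open>The points of a leaf form a linked list; the first component of a tree is a tag.\<close>

primrec enc_bucket :: "point list \<Rightarrow> val" where
  "enc_bucket [] = VUnit"
| "enc_bucket (p # ps) = VPair (enc_point p) (enc_bucket ps)"

primrec enc_tree :: "kdtree \<Rightarrow> val" where
  "enc_tree (Leaf ps) = VPair (VBool True) (enc_bucket ps)"
| "enc_tree (Node i s l r) =
     VPair (VBool False)
       (VPair (VPair (VNat i) (VReal s)) (VPair (enc_tree l) (enc_tree r)))"

primrec enc_tree_option :: "kdtree option \<Rightarrow> val" where
  "enc_tree_option None = VUnit"
| "enc_tree_option (Some T) = enc_tree T"

text \<open>
  The logarithm of asymptotic bounds: \<open>log 2 m\<close> for \<open>m \<ge> 2\<close>, with the usual convention
  that it is never below 1, as otherwise \<open>O(log B * log n)\<close> would be zero for \<open>B = 1\<close>.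
\<close>

definition lg :: "nat \<Rightarrow> real" where
  "lg m = max 1 (log 2 (real m))"

end

theory Submission
  imports Defs
begin

text \<open>
  The batch is first turned into a balanced binary tree with its points at the leaves.
  The deletion descends the kd-tree in parallel; at each internal node it splits the batch
  tree along the hyperplane by two parallel filters.  A filter contracts empty subtrees, so a
  batch tree with \<open>m\<close> points always has \<open>2 * m - 1\<close> nodes, and its height never exceeds
  the initial \<open>O(log B)\<close>: no rebalancing is needed, and each level costs work linear in
  the points present and depth \<open>O(log B)\<close>.  A subtree that receives no point is
  returned at once.  At a leaf each of the at most \<open>b\<close> points is looked up in the
  batch tree by a parallel search.
\<close>

section \<open>Evaluation within cost bounds\<close>

text \<open>Exact costs differ from branch to branch. Upper bounds compose along the syntax of an
  expression and are relaxed to a closed form by one final use of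
  \<open>eval_within_mono\<close>.\<close>

definition eval_within :: "program \<Rightarrow> val list \<Rightarrow> exp \<Rightarrow> val \<Rightarrow> nat \<Rightarrow> nat \<Rightarrow> bool" where
  "eval_within P \<rho> e v W S \<longleftrightarrow> (\<exists>w s. eval P \<rho> e v w s \<and> w \<le> W \<and> s \<le> S)"

lemma eval_within_mono:
  "\<lbrakk>eval_within P \<rho> e v w s; w \<le> W; s \<le> S\<rbrakk> \<Longrightarrow> eval_within P \<rho> e v W S"
  unfolding eval_within_def by (meson le_trans)

lemma eval_withinI: "eval P \<rho> e v w s \<Longrightarrow> eval_within P \<rho> e v w s"
  unfolding eval_within_def by blast

lemma within_Var0: "eval_within P (x # \<rho>) (Var 0) x 1 1"
  using eval.Var[of 0 "x # \<rho>" P] by (simp add: eval_withinI)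

lemma within_Var1: "eval_within P (x # y # \<rho>) (Var 1) y 1 1"
  using eval.Var[of 1 "x # y # \<rho>" P] by (simp add: eval_withinI)

lemma within_UnitC: "eval_within P \<rho> UnitC VUnit 1 1"
  and within_BoolC: "eval_within P \<rho> (BoolC c) (VBool c) 1 1"
  and within_NatC: "eval_within P \<rho> (NatC m) (VNat m) 1 1"
  by (rule eval_withinI, rule eval.intros)+

lemma within_Op1:
  assumes "eval_within P \<rho> e x w s" "unop_val f x = Some v"
  shows "eval_within P \<rho> (Op1 f e) v (w + 1) (s + 1)"
proof -
  obtain w' s' where "eval P \<rho> e x w' s'" "w' \<le> w" "s' \<le> s"
    using assms(1) unfolding eval_within_def by blast
  with eval.Op1[OF this(1) assms(2)] show ?thesis
    unfolding eval_within_def by (intro exI[of _ "w' + 1"] exI[of _ "s' + 1"]) auto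
qed

lemma within_Op2:
  assumes "eval_within P \<rho> e1 x w1 s1" "eval_within P \<rho> e2 y w2 s2" "binop_val f x y = Some v"
  shows "eval_within P \<rho> (Op2 f e1 e2) v (w1 + w2 + 1) (s1 + s2 + 1)"
proof -
  obtain a1 c1 a2 c2 where 1: "eval P \<rho> e1 x a1 c1" "eval P \<rho> e2 y a2 c2"
    and "a1 \<le> w1" "c1 \<le> s1" "a2 \<le> w2" "c2 \<le> s2"
    using assms(1,2) unfolding eval_within_def by blast
  with eval.Op2[OF 1 assms(3)] show ?thesis
    unfolding eval_within_def
    by (intro exI[of _ "a1 + a2 + 1"] exI[of _ "c1 + c2 + 1"]) auto
qed

lemma within_Cond:
  assumes "eval_within P \<rho> e (VBool c) w1 s1" "eval_within P \<rho> (if c then e1 else e2) v w2 s2"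
  shows "eval_within P \<rho> (Cond e e1 e2) v (w1 + w2 + 1) (s1 + s2 + 1)"
proof -
  obtain a1 c1 a2 c2
    where 1: "eval P \<rho> e (VBool c) a1 c1" "eval P \<rho> (if c then e1 else e2) v a2 c2"
    and "a1 \<le> w1" "c1 \<le> s1" "a2 \<le> w2" "c2 \<le> s2"
    using assms unfolding eval_within_def by blast
  with eval.Cond[OF 1] show ?thesis
    unfolding eval_within_def
    by (intro exI[of _ "a1 + a2 + 1"] exI[of _ "c1 + c2 + 1"]) auto
qed

lemma within_LetIn:
  assumes "eval_within P \<rho> e1 x w1 s1" "eval_within P (x # \<rho>) e2 v w2 s2"
  shows "eval_within P \<rho> (LetIn e1 e2) v (w1 + w2 + 1) (s1 + s2 + 1)"
proof -
  obtain a1 c1 a2 c2 where 1: "eval P \<rho> e1 x a1 c1" "eval P (x # \<rho>) e2 v a2 c2"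
    and "a1 \<le> w1" "c1 \<le> s1" "a2 \<le> w2" "c2 \<le> s2"
    using assms unfolding eval_within_def by blast
  with eval.LetIn[OF 1] show ?thesis
    unfolding eval_within_def
    by (intro exI[of _ "a1 + a2 + 1"] exI[of _ "c1 + c2 + 1"]) auto
qed

lemma within_Par:
  assumes "eval_within P \<rho> e1 x w1 s1" "eval_within P \<rho> e2 y w2 s2"
  shows "eval_within P \<rho> (Par e1 e2) (VPair x y) (w1 + w2 + 1) (max s1 s2 + 1)"
proof -
  obtain a1 c1 a2 c2 where 1: "eval P \<rho> e1 x a1 c1" "eval P \<rho> e2 y a2 c2"
    and "a1 \<le> w1" "c1 \<le> s1" "a2 \<le> w2" "c2 \<le> s2"
    using assms unfolding eval_within_def by blast
  with eval.Par[OF 1] show ?thesis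
    unfolding eval_within_def
    by (intro exI[of _ "a1 + a2 + 1"] exI[of _ "max c1 c2 + 1"]) auto
qed

lemma within_Call:
  assumes "eval_within P \<rho> e x w1 s1" "f < length P" "eval_within P [x] (P ! f) v w2 s2"
  shows "eval_within P \<rho> (Call f e) v (w1 + w2 + 1) (s1 + s2 + 1)"
proof -
  obtain a1 c1 a2 c2 where 1: "eval P \<rho> e x a1 c1" "eval P [x] (P ! f) v a2 c2"
    and "a1 \<le> w1" "c1 \<le> s1" "a2 \<le> w2" "c2 \<le> s2"
    using assms(1,3) unfolding eval_within_def by blast
  with eval.Call[OF 1(1) assms(2) 1(2)] show ?thesis
    unfolding eval_within_def
    by (intro exI[of _ "a1 + a2 + 1"] exI[of _ "c1 + c2 + 1"]) auto
qed

text \<open>\<open>within_Cond\<close> leaves a conditional between two program branches. These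
  rules choose the branch, with the condition as the first premise to settle.\<close>

lemma within_if_True: "c \<Longrightarrow> eval_within P \<rho> e1 v w s \<Longrightarrow> eval_within P \<rho> (if c then e1 else e2) v w s"
  and within_if_False: "\<not> c \<Longrightarrow> eval_within P \<rho> e2 v w s \<Longrightarrow> eval_within P \<rho> (if c then e1 else e2) v w s"
  by simp_all

lemma within_Fst:
  "eval_within P \<rho> e (VPair x y) w s \<Longrightarrow> eval_within P \<rho> (Op1 Fst e) x (w + 1) (s + 1)"
  and within_Snd:
  "eval_within P \<rho> e (VPair x y) w s \<Longrightarrow> eval_within P \<rho> (Op1 Snd e) y (w + 1) (s + 1)"
  and within_IsUnit:
  "eval_within P \<rho> e x w s \<Longrightarrow> eval_within P \<rho> (Op1 IsUnit e) (VBool (x = VUnit)) (w + 1) (s + 1)"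
  and within_Half:
  "eval_within P \<rho> e (VNat m) w s \<Longrightarrow> eval_within P \<rho> (Op1 Half e) (VNat (m div 2)) (w + 1) (s + 1)"
  by (erule within_Op1, simp)+

lemma within_Len_point:
  "eval_within P \<rho> e (enc_point p) w s \<Longrightarrow> eval_within P \<rho> (Op1 Len e) (VNat (length p)) (w + 1) (s + 1)"
  and within_Len_batch:
  "eval_within P \<rho> e (enc_batch ps) w s \<Longrightarrow> eval_within P \<rho> (Op1 Len e) (VNat (length ps)) (w + 1) (s + 1)"
  by (erule within_Op1, simp add: enc_point_def enc_batch_def)+

lemma within_MkPair:
  "\<lbrakk>eval_within P \<rho> e1 x w1 s1; eval_within P \<rho> e2 y w2 s2\<rbrakk>
   \<Longrightarrow> eval_within P \<rho> (Op2 MkPair e1 e2) (VPair x y) (w1 + w2 + 1) (s1 + s2 + 1)"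
  and within_Add:
  "\<lbrakk>eval_within P \<rho> e1 (VNat k) w1 s1; eval_within P \<rho> e2 (VNat m) w2 s2\<rbrakk>
   \<Longrightarrow> eval_within P \<rho> (Op2 Add e1 e2) (VNat (k + m)) (w1 + w2 + 1) (s1 + s2 + 1)"
  and within_Sub:
  "\<lbrakk>eval_within P \<rho> e1 (VNat k) w1 s1; eval_within P \<rho> e2 (VNat m) w2 s2\<rbrakk>
   \<Longrightarrow> eval_within P \<rho> (Op2 Sub e1 e2) (VNat (k - m)) (w1 + w2 + 1) (s1 + s2 + 1)"
  and within_Less_real:
  "\<lbrakk>eval_within P \<rho> e1 (VReal x') w1 s1; eval_within P \<rho> e2 (VReal y') w2 s2\<rbrakk>
   \<Longrightarrow> eval_within P \<rho> (Op2 Less e1 e2) (VBool (x' < y')) (w1 + w2 + 1) (s1 + s2 + 1)"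
  and within_Equal_nat:
  "\<lbrakk>eval_within P \<rho> e1 (VNat k) w1 s1; eval_within P \<rho> e2 (VNat m) w2 s2\<rbrakk>
   \<Longrightarrow> eval_within P \<rho> (Op2 Equal e1 e2) (VBool (k = m)) (w1 + w2 + 1) (s1 + s2 + 1)"
  and within_Equal_real:
  "\<lbrakk>eval_within P \<rho> e1 (VReal x') w1 s1; eval_within P \<rho> e2 (VReal y') w2 s2\<rbrakk>
   \<Longrightarrow> eval_within P \<rho> (Op2 Equal e1 e2) (VBool (x' = y')) (w1 + w2 + 1) (s1 + s2 + 1)"
  by (erule (1) within_Op2, simp)+

lemma within_Nth_point:
  "\<lbrakk>eval_within P \<rho> e1 (enc_point p) w1 s1; eval_within P \<rho> e2 (VNat k) w2 s2; k < length p\<rbrakk>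
   \<Longrightarrow> eval_within P \<rho> (Op2 Nth e1 e2) (VReal (p ! k)) (w1 + w2 + 1) (s1 + s2 + 1)"
  and within_Nth_batch:
  "\<lbrakk>eval_within P \<rho> e1 (enc_batch ps) w1 s1; eval_within P \<rho> e2 (VNat k) w2 s2; k < length ps\<rbrakk>
   \<Longrightarrow> eval_within P \<rho> (Op2 Nth e1 e2) (enc_point (ps ! k)) (w1 + w2 + 1) (s1 + s2 + 1)"
  by (erule (1) within_Op2, simp add: enc_point_def enc_batch_def)+

text \<open>The fused form matches only a comparison of two array accesses, whereas
  \<open>within_Equal_real\<close> would also match the comparison of a counter with a
  constant.\<close>

lemmas within_Equal_coord = within_Equal_real[OF within_Nth_point within_Nth_point]

text \<open>The instructions overloaded on value types (\<open>Len\<close>, \<open>Less\<close>,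
  \<open>Equal\<close>, \<open>Nth\<close>) are left out, so that each cost proof selects the right
  version.\<close>

lemmas within_basic =
  within_Var0 within_Var1 within_UnitC within_BoolC within_NatC
  within_Fst within_Snd within_IsUnit within_Half
  within_MkPair within_Add within_Sub
  within_Cond within_LetIn within_Par

section \<open>Batch trees\<close>

text \<open>There is no empty tree: an empty batch is \<open>None\<close>, encoded as
  \<open>VUnit\<close>. Hence the number of nodes is linear in the number of leaves.\<close>

datatype btree = Tip point | Bin btree btree

primrec bpoints :: "btree \<Rightarrow> point set" where
  "bpoints (Tip p) = {p}"
| "bpoints (Bin l r) = bpoints l \<union> bpoints r"

text \<open>Counts with multiplicity: a batch is a list and may repeat points, so the cardinality of
  \<open>bpoints\<close> would be too small a measure.\<close>

primrec leaves :: "btree \<Rightarrow> nat" where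
  "leaves (Tip p) = 1"
| "leaves (Bin l r) = leaves l + leaves r"

primrec bheight :: "btree \<Rightarrow> nat" where
  "bheight (Tip p) = 0"
| "bheight (Bin l r) = Suc (max (bheight l) (bheight r))"

primrec enc_btree :: "btree \<Rightarrow> val" where
  "enc_btree (Tip p) = VPair (VBool True) (enc_point p)"
| "enc_btree (Bin l r) = VPair (VBool False) (VPair (enc_btree l) (enc_btree r))"

primrec enc_btree_option :: "btree option \<Rightarrow> val" where
  "enc_btree_option None = VUnit"
| "enc_btree_option (Some t) = enc_btree t"

fun merge :: "btree option \<Rightarrow> btree option \<Rightarrow> btree option" where
  "merge None u = u"
| "merge t None = t"
| "merge (Some t) (Some u) = Some (Bin t u)"

primrec bfilter :: "(point \<Rightarrow> bool) \<Rightarrow> btree \<Rightarrow> btree option" where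
  "bfilter Q (Tip p) = (if Q p then Some (Tip p) else None)"
| "bfilter Q (Bin l r) = merge (bfilter Q l) (bfilter Q r)"

definition opoints :: "btree option \<Rightarrow> point set" where
  "opoints = case_option {} bpoints"

definition oleaves :: "btree option \<Rightarrow> nat" where
  "oleaves = case_option 0 leaves"

definition oheight :: "btree option \<Rightarrow> nat" where
  "oheight = case_option 0 bheight"

lemma option_simps [simp]:
  "opoints None = {}" "opoints (Some t) = bpoints t"
  "oleaves None = 0" "oleaves (Some t) = leaves t"
  "oheight None = 0" "oheight (Some t) = bheight t"
  by (simp_all add: opoints_def oleaves_def oheight_def)

lemma leaves_pos: "leaves t \<ge> 1"
  by (induction t) auto

lemma enc_btree_neq_VUnit [simp]: "enc_btree t \<noteq> VUnit"
  by (cases t) auto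

lemma enc_tree_neq_VUnit [simp]: "enc_tree T \<noteq> VUnit"
  by (cases T) auto

lemma opoints_merge: "opoints (merge t u) = opoints t \<union> opoints u"
  and oleaves_merge: "oleaves (merge t u) = oleaves t + oleaves u"
  and oheight_merge: "oheight (merge t u) \<le> Suc (max (oheight t) (oheight u))"
  by (cases t; cases u; simp)+

lemma opoints_bfilter: "opoints (bfilter Q t) = {p \<in> bpoints t. Q p}"
  by (induction t) (auto simp: opoints_merge)

text \<open>Each leaf passes exactly one of two complementary filters, so the two recursive
  deletions share the batch without duplicating it.\<close>

lemma oleaves_bfilter: "oleaves (bfilter Q t) + oleaves (bfilter (\<lambda>p. \<not> Q p) t) = leaves t"
  by (induction t) (auto simp: oleaves_merge)

text \<open>Merging with an empty side adds no level, and merging two nonempty sides restores the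
  level of the original \<open>Bin\<close>.\<close>

lemma oheight_bfilter: "oheight (bfilter Q t) \<le> bheight t"
proof (induction t)
  case (Bin l r)
  have "oheight (bfilter Q (Bin l r)) \<le> Suc (max (oheight (bfilter Q l)) (oheight (bfilter Q r)))"
    using oheight_merge by simp
  with Bin.IH show ?case by (simp add: le_max_iff_disj max_def split: if_splits)
qed simp

section \<open>The program\<close>

text \<open>
  Arguments are passed as nested pairs; the calling conventions are:
  0 (tree, batch array); 1 (batch array, (offset, count));
  2 (side, ((dimension, value), batch tree)); 3 (number of coordinates, (point, point));
  4 (point, batch tree); 5 (batch tree, bucket); 6 (tree, batch tree or unit).
\<close>

abbreviation "fstE \<equiv> Op1 Fst"
abbreviation "sndE \<equiv> Op1 Snd"
abbreviation "pairE \<equiv> Op2 MkPair"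
abbreviation "argE \<equiv> Var 0"

definition main_code :: exp where
  "main_code = Call 6 (pairE (fstE argE)
     (Call 1 (pairE (sndE argE) (pairE (NatC 0) (Op1 Len (sndE argE))))))"

text \<open>The HOL \<open>let\<close> only abbreviates syntax: every occurrence is evaluated anew,
  at constant cost. Sharing of results needs \<open>LetIn\<close>.\<close>

definition build_code :: exp where
  "build_code =
     (let arr = fstE argE; off = fstE (sndE argE); cnt = sndE (sndE argE)
      in Cond (Op2 Equal cnt (NatC 1))
           (pairE (BoolC True) (Op2 Nth arr off))
           (pairE (BoolC False)
              (Par (Call 1 (pairE arr (pairE off (Op1 Half cnt))))
                   (Call 1 (pairE arr (pairE (Op2 Add off (Op1 Half cnt))
                                             (Op2 Sub cnt (Op1 Half cnt))))))))"

text \<open>Contracts the pair of results at \<open>Var 0\<close>, with \<open>VUnit\<close> for an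
  empty one. The parameter \<open>e\<close> computes the payload of a node kept with both children,
  so filter and deletion can use the same code.\<close>

definition merge_code :: "exp \<Rightarrow> exp" where
  "merge_code e =
     Cond (Op1 IsUnit (fstE (Var 0))) (sndE (Var 0))
       (Cond (Op1 IsUnit (sndE (Var 0))) (fstE (Var 0)) (pairE (BoolC False) e))"

definition filter_code :: exp where
  "filter_code =
     (let side = fstE argE; cut = fstE (sndE argE); t = sndE (sndE argE)
      in Cond (fstE t)
           (Cond (Op2 Less (Op2 Nth (sndE t) (fstE cut)) (sndE cut))
              (Cond side t UnitC) (Cond side UnitC t))
           (LetIn (Par (Call 2 (pairE side (pairE cut (fstE (sndE t)))))
                       (Call 2 (pairE side (pairE cut (sndE (sndE t))))))
              (merge_code (Var 0))))"

text \<open>Arrays have no unit-cost equality. Coordinates are compared from the last one down, at a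
  cost linear in the dimension.\<close>

definition eq_code :: exp where
  "eq_code =
     (let k = fstE argE; p = fstE (sndE argE); q = sndE (sndE argE); k' = Op2 Sub k (NatC 1)
      in Cond (Op2 Equal k (NatC 0)) (BoolC True)
           (Cond (Op2 Equal (Op2 Nth p k') (Op2 Nth q k'))
              (Call 3 (pairE k' (sndE argE))) (BoolC False)))"

text \<open>The batch tree is not a search tree, so all leaves are inspected. Searching both halves
  in \<open>Par\<close> keeps the depth proportional to the height.\<close>

definition mem_code :: exp where
  "mem_code =
     (let p = fstE argE; t = sndE argE
      in Cond (fstE t) (Call 3 (pairE (Op1 Len p) (pairE p (sndE t))))
           (LetIn (Par (Call 4 (pairE p (fstE (sndE t)))) (Call 4 (pairE p (sndE (sndE t)))))
              (Cond (fstE (Var 0)) (BoolC True) (sndE (Var 0)))))"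

text \<open>Under \<open>LetIn\<close> the argument moves from \<open>Var 0\<close> to
  \<open>Var 1\<close>, hence the shifted copies \<open>t1\<close> and \<open>p1\<close>.\<close>

definition bucket_code :: exp where
  "bucket_code =
     (let t = fstE argE; ps = sndE argE; t1 = fstE (Var 1); p1 = fstE (sndE (Var 1))
      in Cond (Op1 IsUnit ps) UnitC
           (LetIn (Call 5 (pairE t (sndE ps)))
              (Cond (Call 4 (pairE p1 t1)) (Var 0) (pairE p1 (Var 0)))))"

definition delete_code :: exp where
  "delete_code =
     (let T = fstE argE; t = sndE argE; cut = fstE (sndE T); cut1 = fstE (sndE (fstE (Var 1)))
      in Cond (Op1 IsUnit t) T
           (Cond (fstE T)
              (LetIn (Call 5 (pairE t (sndE T)))
                 (Cond (Op1 IsUnit (Var 0)) UnitC (pairE (BoolC True) (Var 0))))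
              (LetIn
                 (Par (Call 6 (pairE (fstE (sndE (sndE T)))
                                 (Call 2 (pairE (BoolC True) (pairE cut t)))))
                      (Call 6 (pairE (sndE (sndE (sndE T)))
                                 (Call 2 (pairE (BoolC False) (pairE cut t))))))
                 (merge_code (pairE cut1 (Var 0))))))"

definition kd_program :: program where
  "kd_program = [main_code, build_code, filter_code, eq_code, mem_code, bucket_code, delete_code]"

abbreviation call_within :: "exp \<Rightarrow> val \<Rightarrow> val \<Rightarrow> nat \<Rightarrow> nat \<Rightarrow> bool" where
  "call_within c x \<equiv> eval_within kd_program [x] c"

lemma within_calls:
  assumes "eval_within kd_program \<rho> e x w1 s1"
  shows within_build: "call_within build_code x v w s
      \<Longrightarrow> eval_within kd_program \<rho> (Call 1 e) v (w1 + w + 1) (s1 + s + 1)"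
    and within_filter: "call_within filter_code x v w s
      \<Longrightarrow> eval_within kd_program \<rho> (Call 2 e) v (w1 + w + 1) (s1 + s + 1)"
    and within_eq: "call_within eq_code x v w s
      \<Longrightarrow> eval_within kd_program \<rho> (Call 3 e) v (w1 + w + 1) (s1 + s + 1)"
    and within_mem: "call_within mem_code x v w s
      \<Longrightarrow> eval_within kd_program \<rho> (Call 4 e) v (w1 + w + 1) (s1 + s + 1)"
    and within_bucket: "call_within bucket_code x v w s
      \<Longrightarrow> eval_within kd_program \<rho> (Call 5 e) v (w1 + w + 1) (s1 + s + 1)"
    and within_delete: "call_within delete_code x v w s
      \<Longrightarrow> eval_within kd_program \<rho> (Call 6 e) v (w1 + w + 1) (s1 + s + 1)"
  by (rule within_Call[OF assms]; simp add: kd_program_def)+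

lemmas within_rules = within_basic within_calls

text \<open>The result has the conditional shape of \<open>enc_merge\<close> and
  \<open>enc_join_children\<close>, so one rule serves the filter and the deletion.\<close>

lemma within_merge_code:
  assumes "eval_within P (VPair x y # \<rho>) e v w s"
  shows "eval_within P (VPair x y # \<rho>) (merge_code e)
     (if x = VUnit then y else if y = VUnit then x else VPair (VBool False) v) (w + 10) (s + 10)"
proof -
  consider "x = VUnit" | "x \<noteq> VUnit" "y = VUnit" | "x \<noteq> VUnit" "y \<noteq> VUnit" by blast
  then show ?thesis
  proof cases
    case 1
    have "eval_within P (VPair x y # \<rho>) (merge_code e) y (w + 10) (s + 10)"
      unfolding merge_code_def
      \<comment> \<open>The bounds stay schematic while the rules follow the syntax, leaving two
        inequalities. \<open>(simp; fail)\<close> succeeds only if \<open>simp\<close> closes the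
        goal, so a branch is taken only when its condition is proved.\<close>
      by (rule eval_within_mono, (rule within_basic | (rule within_if_True, (simp add: 1; fail)))+) auto
    with 1 show ?thesis by simp
  next
    case 2
    have "eval_within P (VPair x y # \<rho>) (merge_code e) x (w + 10) (s + 10)"
      unfolding merge_code_def
      by (rule eval_within_mono, (rule within_basic | (rule within_if_True, (simp add: 2; fail))
         | (rule within_if_False, (simp add: 2; fail)))+) auto
    with 2 show ?thesis by simp
  next
    case 3
    \<comment> \<open>The constant 10 is attained here: 3 for each of two tests, 1 for each
      \<open>Cond\<close>, 2 for the tag and the pairing.\<close>
    have "eval_within P (VPair x y # \<rho>) (merge_code e) (VPair (VBool False) v) (w + 10) (s + 10)"
      unfolding merge_code_def
      by (rule eval_within_mono, (rule assms within_basic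
         | (rule within_if_False, (simp add: 3; fail)))+) auto
    with 3 show ?thesis by simp
  qed
qed


section \<open>Correctness and cost of the functions\<close>

text \<open>Propagates \<open>2 ^ h < 2 * m\<close> through halving with rounding up. For
  \<open>h > 0\<close> both sides of the hypothesis are even, so they differ by at least 2, while
  rounding loses only 1.\<close>

lemma pow_height_step:
  fixes h m m' :: nat
  assumes "2 ^ h < 2 * m'" "m' \<le> (m + 1) div 2" "2 \<le> m"
  shows "2 ^ Suc h < 2 * m"
proof (cases h)
  case (Suc g)
  then have "2 ^ g < m'" using assms(1) by simp
  then have "2 ^ h + 2 \<le> 2 * m'" using Suc by simp
  with assms(2) show ?thesis by simp
qed (use assms in simp)

text \<open>The offset in \<open>100 * m - 50\<close> makes the induction close: the two halves add
  up to \<open>100 * m - 100\<close>, which leaves 50 for the node itself.\<close>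

lemma build_within:
  assumes "1 \<le> m" "k + m \<le> length ps"
  shows "\<exists>t. call_within build_code (VPair (enc_batch ps) (VPair (VNat k) (VNat m))) (enc_btree t)
               (100 * m - 50) (80 * (bheight t + 1)) \<and>
             bpoints t = set (take m (drop k ps)) \<and> leaves t = m \<and> 2 ^ bheight t < 2 * m"
  using assms
proof (induction m arbitrary: k rule: less_induct)
  case (less m)
  show ?case
  proof (cases "m = 1")
    case True
    have "call_within build_code (VPair (enc_batch ps) (VPair (VNat k) (VNat m)))
        (VPair (VBool True) (enc_point (ps ! k))) (100 * m - 50) 80"
      unfolding build_code_def Let_def
      apply (rule eval_within_mono)
        apply (rule within_basic within_Equal_nat within_Nth_batch
            within_if_True[OF True])+
      using less.prems True by auto
    moreover have "take m (drop k ps) = [ps ! k]"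
      using True less.prems by (simp add: Cons_nth_drop_Suc[symmetric])
    ultimately show ?thesis using True by (intro exI[of _ "Tip (ps ! k)"]) simp
  next
    case False
    with less.prems have m: "2 \<le> m" by simp
    have half: "m div 2 < m" "1 \<le> m div 2" "m - m div 2 < m" "1 \<le> m - m div 2"
      "k + m div 2 \<le> length ps" "k + m div 2 + (m - m div 2) \<le> length ps"
      using m less.prems by auto
    obtain l where l: "call_within build_code (VPair (enc_batch ps) (VPair (VNat k) (VNat (m div 2))))
        (enc_btree l) (100 * (m div 2) - 50) (80 * (bheight l + 1))"
      and l': "bpoints l = set (take (m div 2) (drop k ps))" "leaves l = m div 2"
        "2 ^ bheight l < 2 * (m div 2)"
      using less.IH[OF half(1,2,5)] by blast
    obtain r where r: "call_within build_code
        (VPair (enc_batch ps) (VPair (VNat (k + m div 2)) (VNat (m - m div 2))))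
        (enc_btree r) (100 * (m - m div 2) - 50) (80 * (bheight r + 1))"
      and r': "bpoints r = set (take (m - m div 2) (drop (k + m div 2) ps))"
        "leaves r = m - m div 2" "2 ^ bheight r < 2 * (m - m div 2)"
      using less.IH[OF half(3,4,6)] by blast
    have "call_within build_code (VPair (enc_batch ps) (VPair (VNat k) (VNat m)))
        (enc_btree (Bin l r)) (100 * m - 50) (80 * (bheight (Bin l r) + 1))"
      unfolding build_code_def Let_def enc_btree.simps
      apply (rule eval_within_mono)
        apply (rule l r within_rules within_Equal_nat
            within_if_False[OF False])+
      using half by auto
    moreover have "take m (drop k ps) =
        take (m div 2) (drop k ps) @ take (m - m div 2) (drop (k + m div 2) ps)"
      using take_add[of "m div 2" "m - m div 2" "drop k ps"] by (simp add: add.commute)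
    then have "bpoints (Bin l r) = set (take m (drop k ps))"
      using l'(1) r'(1) by (metis bpoints.simps(2) set_append)
    moreover have "2 ^ bheight (Bin l r) < 2 * m"
      using pow_height_step[OF l'(3) _ m] pow_height_step[OF r'(3) _ m] by (simp add: max_def)
    ultimately show ?thesis using l'(2) r'(2) by (intro exI[of _ "Bin l r"]) simp
  qed
qed

section \<open>Splitting the batch along a hyperplane\<close>

lemma enc_merge:
  "enc_btree_option (merge t u) =
     (if enc_btree_option t = VUnit then enc_btree_option u
      else if enc_btree_option u = VUnit then enc_btree_option t
      else VPair (VBool False) (VPair (enc_btree_option t) (enc_btree_option u)))"
  by (cases t; cases u) simp_all

text \<open>The flag \<open>c\<close> selects the side, so one statement covers both filters. The
  work offset pays for a node as in \<open>build_within\<close>.\<close>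

lemma filter_within:
  assumes "bpoints t \<subseteq> space_dim d" "i < d"
  shows "call_within filter_code
     (VPair (VBool c) (VPair (VPair (VNat i) (VReal x)) (enc_btree t)))
     (enc_btree_option (bfilter (\<lambda>p. (p ! i < x) = c) t))
     (100 * leaves t - 50) (80 * (bheight t + 1))"
  using assms(1)
proof (induction t)
  case (Tip p)
  \<comment> \<open>\<open>Nth\<close> has a value only inside the array; the dimension hypotheses
    guarantee the access.\<close>
  then have i: "i < length p" using assms(2) by (simp add: space_dim_def)
  show ?case
    unfolding filter_code_def Let_def enc_btree.simps bfilter.simps
    apply (cases "p ! i < x"; cases c; simp)
       apply (rule eval_within_mono, (rule within_basic within_Less_real within_Nth_point i
            | (rule within_if_True, (simp; fail)) | (rule within_if_False, (simp; fail)))+, simp, simp)+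
    done
next
  case (Bin l r)
  then have IH: "call_within filter_code
     (VPair (VBool c) (VPair (VPair (VNat i) (VReal x)) (enc_btree l)))
     (enc_btree_option (bfilter (\<lambda>p. (p ! i < x) = c) l)) (100 * leaves l - 50) (80 * (bheight l + 1))"
   "call_within filter_code
     (VPair (VBool c) (VPair (VPair (VNat i) (VReal x)) (enc_btree r)))
     (enc_btree_option (bfilter (\<lambda>p. (p ! i < x) = c) r)) (100 * leaves r - 50) (80 * (bheight r + 1))"
    by auto
  show ?case
    unfolding filter_code_def Let_def enc_btree.simps bfilter.simps enc_merge
    apply (rule eval_within_mono)
      apply (rule IH within_merge_code within_rules
        | (rule within_if_True, (simp; fail)) | (rule within_if_False, (simp; fail)))+
    using leaves_pos[of l] leaves_pos[of r] by auto
qed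

section \<open>Comparing points and searching the batch\<close>

lemma eq_within:
  assumes "k \<le> length p" "k \<le> length q"
  shows "call_within eq_code (VPair (VNat k) (VPair (enc_point p) (enc_point q)))
     (VBool (take k p = take k q)) (40 * (k + 1)) (40 * (k + 1))"
  using assms
proof (induction k)
  case 0
  show ?case
    unfolding eq_code_def Let_def
    by (rule eval_within_mono, (rule within_basic within_Equal_nat
        | (rule within_if_True, (simp; fail)))+) (auto intro!: within_BoolC)
next
  case (Suc k)
  \<comment> \<open>The counter stays in the form \<open>Suc k - 1\<close>, the literal result of
    \<open>Sub\<close>, so that the rules match.\<close>
  have IH: "call_within eq_code (VPair (VNat (Suc k - 1)) (VPair (enc_point p) (enc_point q)))
     (VBool (take k p = take k q)) (40 * (k + 1)) (40 * (k + 1))"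
    using Suc by simp
  have k: "Suc k - 1 < length p" "Suc k - 1 < length q" using Suc.prems by auto
  have eq: "take (Suc k) p = take (Suc k) q \<longleftrightarrow> take k p = take k q \<and> p ! k = q ! k"
    using k by (simp add: take_Suc_conv_app_nth)
  show ?case
  proof (cases "p ! k = q ! k")
    case True
    then have "(take (Suc k) p = take (Suc k) q) = (take k p = take k q)" using eq by simp
    then show ?thesis
      unfolding eq_code_def Let_def
      apply (simp only:)
      apply (rule eval_within_mono)
        apply (rule IH k within_Equal_coord within_rules within_Equal_nat
          | (rule within_if_True, (simp add: True; fail)) | (rule within_if_False, (simp; fail)))+
      by auto
  next
    case False
    then have "(take (Suc k) p = take (Suc k) q) = False" using eq by simp
    then show ?thesis
      unfolding eq_code_def Let_def
      apply (simp only:)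
      apply (rule eval_within_mono)
        apply (rule k within_Equal_coord within_rules within_Equal_nat
          | (rule within_if_False, (simp add: False; fail)))+
      by auto
  qed
qed

text \<open>\<open>A\<close> bounds the own cost of any node, including a comparison at a
  \<open>Tip\<close>. A tree with m leaves has 2m - 1 nodes, whence the work bound.\<close>

lemma mem_within:
  assumes "length p = d" "bpoints t \<subseteq> space_dim d"
  defines "A \<equiv> 40 * d + 100"
  shows "call_within mem_code (VPair (enc_point p) (enc_btree t)) (VBool (p \<in> bpoints t))
     (2 * (A * leaves t) - A) (A * (bheight t + 1))"
  using assms(2)
proof (induction t)
  case (Tip q)
  then have q: "length q = d" by (simp add: space_dim_def)
  have E: "call_within eq_code (VPair (VNat (length p)) (VPair (enc_point p) (enc_point q)))
     (VBool (p \<in> bpoints (Tip q))) (40 * (length p + 1)) (40 * (length p + 1))"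
    using eq_within[of "length p" p q] q assms(1) by simp
  show ?case
    unfolding mem_code_def Let_def enc_btree.simps
    apply (rule eval_within_mono)
      apply (rule E within_rules within_Len_point | (rule within_if_True, (simp; fail)))+
    using assms(1) by (auto simp: A_def)
next
  case (Bin l r)
  then have IH: "call_within mem_code (VPair (enc_point p) (enc_btree l)) (VBool (p \<in> bpoints l))
     (2 * (A * leaves l) - A) (A * (bheight l + 1))"
    "call_within mem_code (VPair (enc_point p) (enc_btree r)) (VBool (p \<in> bpoints r))
     (2 * (A * leaves r) - A) (A * (bheight r + 1))" by auto
  \<comment> \<open>The products with \<open>A\<close> are atoms for \<open>linarith\<close>;
    \<open>A \<le> A * leaves l\<close> shows that the natural subtraction does not
    truncate.\<close>
  have A: "100 \<le> A" "A \<le> A * leaves l" "A \<le> A * leaves r"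
    "A * leaves (Bin l r) = A * leaves l + A * leaves r"
    using leaves_pos[of l] leaves_pos[of r]
    by (simp_all only: leaves.simps distrib_left) (simp_all add: A_def)
  have "A * (bheight u + 1) + A \<le> A * (bheight (Bin l r) + 1)" if "u = l \<or> u = r" for u
  proof -
    have "A * (bheight u + 2) \<le> A * (bheight (Bin l r) + 1)"
      using that by (intro mult_le_mono) auto
    then show ?thesis by (simp add: algebra_simps)
  qed
  from this[of l] this[of r]
  have S: "A * (bheight l + 1) + A \<le> A * (bheight (Bin l r) + 1)"
    "A * (bheight r + 1) + A \<le> A * (bheight (Bin l r) + 1)" by simp_all
  show ?case
  proof (cases "p \<in> bpoints l")
    case True
    then have eq: "(p \<in> bpoints (Bin l r)) = True" by simp
    show ?thesis
      unfolding mem_code_def Let_def enc_btree.simps eq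
      apply (rule eval_within_mono)
        apply (rule IH within_rules within_if_True[OF True] | (rule within_if_False, (simp; fail)))+
      using A S by linarith+
  next
    case False
    then have eq: "(p \<in> bpoints (Bin l r)) = (p \<in> bpoints r)" by simp
    show ?thesis
      unfolding mem_code_def Let_def enc_btree.simps eq
      apply (rule eval_within_mono)
        apply (rule IH within_rules within_if_False[OF False] | (rule within_if_False, (simp; fail)))+
      using A S by linarith+
  qed
qed

lemma enc_bucket_eq_VUnit [simp]: "enc_bucket ps = VUnit \<longleftrightarrow> ps = []"
  by (cases ps) auto

text \<open>The linked list is processed sequentially, so the depth gains the factor
  \<open>length ps + 1\<close> too; the leaf capacity keeps it constant.\<close>

lemma bucket_within:
  assumes "\<And>p. p \<in> set ps \<Longrightarrow>
    call_within mem_code (VPair (enc_point p) (enc_btree t)) (VBool (p \<in> D)) w s"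
  shows "call_within bucket_code (VPair (enc_btree t) (enc_bucket ps))
     (enc_bucket (filter (\<lambda>p. p \<notin> D) ps)) ((w + 40) * (length ps + 1)) ((s + 40) * (length ps + 1))"
  using assms
proof (induction ps)
  case Nil
  show ?case
    unfolding bucket_code_def Let_def enc_bucket.simps
    by (rule eval_within_mono, (rule within_basic
        | (rule within_if_True, (simp; fail)))+) (auto intro!: within_UnitC)
next
  case (Cons p ps)
  then have IH: "call_within bucket_code (VPair (enc_btree t) (enc_bucket ps))
     (enc_bucket (filter (\<lambda>p. p \<notin> D) ps)) ((w + 40) * (length ps + 1)) ((s + 40) * (length ps + 1))"
    and M: "call_within mem_code (VPair (enc_point p) (enc_btree t)) (VBool (p \<in> D)) w s"
    by simp_all
  show ?case
  proof (cases "p \<in> D")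
    case True
    then have eq: "filter (\<lambda>p. p \<notin> D) (p # ps) = filter (\<lambda>p. p \<notin> D) ps" by simp
    show ?thesis
      unfolding bucket_code_def Let_def enc_bucket.simps(2) eq
      apply (rule eval_within_mono)
        apply (rule IH M within_rules within_if_True[OF True] | (rule within_if_False, (simp; fail)))+
      by auto
  next
    case False
    then have eq: "filter (\<lambda>p. p \<notin> D) (p # ps) = p # filter (\<lambda>p. p \<notin> D) ps" by simp
    show ?thesis
      unfolding bucket_code_def Let_def enc_bucket.simps(2) eq
      apply (rule eval_within_mono)
        apply (rule IH M within_rules within_if_False[OF False] | (rule within_if_False, (simp; fail)))+
      by auto
  qed
qed

section \<open>Deletion from a median-split tree\<close>

primrec kheight :: "kdtree \<Rightarrow> nat" where
  "kheight (Leaf ps) = 0"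
| "kheight (Node i s l r) = Suc (max (kheight l) (kheight r))"

text \<open>A median split leaves at most \<open>(card X + 1) div 2\<close> points on either side,
  and nonempty children force \<open>2 \<le> card X\<close>, so \<open>pow_height_step\<close>
  applies at each node.\<close>

lemma median_kdtree_height:
  "median_kdtree d b X T \<Longrightarrow> 2 ^ kheight T < 2 * card X"
proof (induction rule: median_kdtree.induct)
  case (leaf ps)
  then have "card (set ps) > 0" by (simp add: card_gt_0_iff)
  then show ?case by simp
next
  case (node i L X s R l r)
  have fin: "finite L" "finite R" "L \<noteq> {}" "R \<noteq> {}"
    using points_median_kdtree[OF node.hyps(5)] points_median_kdtree[OF node.hyps(6)] by auto
  have "X = L \<union> R" "L \<inter> R = {}" unfolding node.hyps(2,3) by auto
  then have card: "card X = card L + card R" using fin by (simp add: card_Un_disjoint)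
  moreover have "card L > 0" "card R > 0" using fin by (simp_all add: card_gt_0_iff)
  ultimately have "2 \<le> card X" "card L \<le> (card X + 1) div 2" "card R \<le> (card X + 1) div 2"
    using node.hyps(4) by auto
  with pow_height_step[OF node.IH(1)] pow_height_step[OF node.IH(2)]
  show ?case by (simp add: max_def)
qed

text \<open>Taking logarithms gives \<open>h + 1 < 2 + log 2 m\<close>; the 2 is absorbed because
  \<open>lg m\<close> is at least 1.\<close>

lemma height_le_lg:
  assumes "2 ^ h < 2 * m"
  shows "real h + 1 \<le> 3 * lg m"
proof -
  have "m > 0" using assms by (cases m) auto
  have "2 ^ h < 2 * real m"
    using assms by (metis of_nat_less_iff of_nat_mult of_nat_numeral of_nat_power)
  then have "log 2 (2 ^ h) < log 2 (2 * real m)"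
    using \<open>m > 0\<close> by (subst log_less_cancel_iff) auto
  then have "real h < 1 + log 2 (real m)" using \<open>m > 0\<close> by (simp add: log_mult log_nat_power)
  then show ?thesis unfolding lg_def by linarith
qed

text \<open>Reconciles the specification, which passes the whole batch to both children, with the
  program, which passes each child its filtered share.\<close>

lemma delete_points_cong:
  "D \<inter> points T = D' \<inter> points T \<Longrightarrow> delete_points D T = delete_points D' T"
proof (induction T)
  case (Leaf ps)
  then have "filter (\<lambda>p. p \<notin> D) ps = filter (\<lambda>p. p \<notin> D') ps"
    by (intro filter_cong) auto
  then show ?case by simp
next
  case (Node i s l r)
  then have "delete_points D l = delete_points D' l" "delete_points D r = delete_points D' r"
    by (intro Node.IH; force)+
  then show ?case by simp
qed

text \<open>Justifies the early return on an empty batch. It relies on leaves being nonempty, since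
  \<open>delete_points\<close> would remove an empty leaf.\<close>

lemma delete_points_empty: "median_kdtree d b X T \<Longrightarrow> delete_points {} T = Some T"
  by (induction rule: median_kdtree.induct) auto

lemma enc_join_children:
  "enc_tree_option (join_children i s t u) =
     (if enc_tree_option t = VUnit then enc_tree_option u
      else if enc_tree_option u = VUnit then enc_tree_option t
      else VPair (VBool False)
        (VPair (VPair (VNat i) (VReal s)) (VPair (enc_tree_option t) (enc_tree_option u))))"
  by (cases t; cases u) simp_all

text \<open>
  The number \<open>oleaves t\<close> is split between the two children, which makes the work bound
  additive; the fixed bound \<open>H\<close> on the height of the batch trees serves for all levels.
\<close>

lemma delete_within:
  fixes d b H :: nat
  defines "M \<equiv> (2 * (40 * d + 100) + 40) * (b + 1) + 500"
  assumes "median_kdtree d b X T" "opoints t \<subseteq> space_dim d" "oheight t \<le> H"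
  shows "call_within delete_code (VPair (enc_tree T) (enc_btree_option t))
     (enc_tree_option (delete_points (opoints t) T))
     (10 + M * oleaves t * (kheight T + 1)) (10 + M * (H + 1) * (kheight T + 1))"
  using assms(2-)
proof (induction X T arbitrary: t rule: median_kdtree.induct)
  case (leaf ps)
  show ?case
  proof (cases t)
    \<comment> \<open>With \<open>oleaves t = 0\<close> only the 10 remains for the work; it covers
      the \<open>IsUnit\<close> test and the return of the tree.\<close>
    case None
    have eq: "enc_tree_option (delete_points (opoints t) (Leaf ps)) = enc_tree (Leaf ps)"
      using None leaf by simp
    show ?thesis
      unfolding delete_code_def Let_def eq
      apply (rule eval_within_mono)
        apply (rule within_rules | (rule within_if_True, (simp add: None; fail)))+
      by auto
  next
    case (Some u)
    define A where "A = 40 * d + 100"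
    define w where "w = 2 * (A * leaves u) - A"
    define s where "s = A * (bheight u + 1)"
    define qs where "qs = filter (\<lambda>p. p \<notin> bpoints u) ps"
    have "call_within mem_code (VPair (enc_point p) (enc_btree u)) (VBool (p \<in> bpoints u)) w s"
      if "p \<in> set ps" for p
      using that leaf Some unfolding w_def s_def A_def
      by (intro mem_within) (auto simp: space_dim_def)
    from bucket_within[OF this]
    have Bu: "call_within bucket_code (VPair (enc_btree u) (enc_bucket ps)) (enc_bucket qs)
       ((w + 40) * (length ps + 1)) ((s + 40) * (length ps + 1))" unfolding qs_def .
    have u1: "1 \<le> leaves u" by (rule leaves_pos)
    \<comment> \<open>This is the source of the first summand of \<open>M\<close>:
      \<open>w + 40\<close> is at most \<open>leaves u * (2 * A + 40)\<close>, for at most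
      \<open>b\<close> points. The remaining operations fit into the 500.\<close>
    have "(w + 40) * (length ps + 1) \<le> (leaves u * (2 * A + 40)) * (b + 1)"
      using leaf u1 unfolding w_def by (intro mult_le_mono) (auto simp: algebra_simps)
    then have W: "(w + 40) * (length ps + 1) + 40 \<le> M * leaves u"
      using u1 by (simp add: M_def A_def algebra_simps)
    have "s \<le> A * (H + 1)"
      using leaf.prems(2) Some unfolding s_def by (intro mult_le_mono) auto
    then have "s + 40 \<le> (H + 1) * (2 * A + 40)" by (simp add: algebra_simps)
    then have "(s + 40) * (length ps + 1) \<le> ((H + 1) * (2 * A + 40)) * (b + 1)"
      using leaf.hyps(3) by (intro mult_le_mono) simp_all
    then have S: "(s + 40) * (length ps + 1) + 40 \<le> M * (H + 1)"
      by (simp add: M_def A_def algebra_simps)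
    show ?thesis
    proof (cases "qs = []")
      case True
      then have eq: "enc_tree_option (delete_points (opoints t) (Leaf ps)) = VUnit"
        using Some by (simp add: qs_def)
      show ?thesis
        unfolding delete_code_def Let_def eq enc_tree.simps
        unfolding Some enc_btree_option.simps
        apply (rule eval_within_mono)
          apply (rule Bu within_rules | (rule within_if_True, (simp add: True; fail))
            | (rule within_if_False, (simp; fail)))+
        using W S by auto
    next
      case False
      then have eq: "enc_tree_option (delete_points (opoints t) (Leaf ps)) = VPair (VBool True) (enc_bucket qs)"
        using Some by (simp add: qs_def)
      show ?thesis
        unfolding delete_code_def Let_def eq enc_tree.simps
        unfolding Some enc_btree_option.simps
        apply (rule eval_within_mono)
          apply (rule Bu within_rules | (rule within_if_True, (simp; fail))
            | (rule within_if_False, (simp add: False; fail)))+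
        using W S by auto
    qed
  qed
next
  case (node i L X s R l r)
  show ?case
  proof (cases t)
    case None
    have "delete_points {} (Node i s l r) = Some (Node i s l r)"
      by (rule delete_points_empty[OF median_kdtree.node]) (rule node.hyps)+
    then have eq: "enc_tree_option (delete_points (opoints t) (Node i s l r)) = enc_tree (Node i s l r)"
      using None by simp
    show ?thesis
      unfolding delete_code_def Let_def eq
      apply (rule eval_within_mono)
        apply (rule within_rules | (rule within_if_True, (simp add: None; fail)))+
      by auto
  next
    case (Some u)
    \<comment> \<open>The forms \<open>= True\<close> and \<open>= False\<close> match the flag of
      \<open>filter_within\<close>.\<close>
    define tl where "tl = bfilter (\<lambda>p. (p ! i < s) = True) u"
    define tr where "tr = bfilter (\<lambda>p. (p ! i < s) = False) u"
    define K where "K = max (kheight l) (kheight r)"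
    have u: "bpoints u \<subseteq> space_dim d" "bheight u \<le> H" using node.prems Some by auto
    have F: "call_within filter_code
       (VPair (VBool True) (VPair (VPair (VNat i) (VReal s)) (enc_btree u)))
       (enc_btree_option tl) (100 * leaves u - 50) (80 * (bheight u + 1))"
      "call_within filter_code
       (VPair (VBool False) (VPair (VPair (VNat i) (VReal s)) (enc_btree u)))
       (enc_btree_option tr) (100 * leaves u - 50) (80 * (bheight u + 1))"
      unfolding tl_def tr_def by (rule filter_within[OF u(1) node.hyps(1)])+
    have pts: "opoints tl = {p \<in> bpoints u. p ! i < s}" "opoints tr = {p \<in> bpoints u. \<not> p ! i < s}"
      by (simp_all add: tl_def tr_def opoints_bfilter)
    have lv: "oleaves tl + oleaves tr = leaves u"
      unfolding tl_def tr_def using oleaves_bfilter[of "\<lambda>p. p ! i < s" u] by simp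
    have ht: "oheight tl \<le> H" "oheight tr \<le> H"
      unfolding tl_def tr_def using oheight_bfilter u(2) le_trans by blast+
    have "opoints tl \<subseteq> space_dim d" "opoints tr \<subseteq> space_dim d" using pts u(1) by auto
    note IH = node.IH(1)[OF this(1) ht(1)] node.IH(2)[OF this(2) ht(2)]
    have "points l = L" "points r = R"
      using points_median_kdtree[OF node.hyps(5)] points_median_kdtree[OF node.hyps(6)] by auto
    \<comment> \<open>The hyperplane decides the side of every point: batch points in
      \<open>L\<close> all pass the left filter, those in \<open>R\<close> the right one.\<close>
    then have "delete_points (opoints t) l = delete_points (opoints tl) l"
      "delete_points (opoints t) r = delete_points (opoints tr) r"
      by (intro delete_points_cong; auto simp: Some pts node.hyps(2,3))+
    then have eq: "delete_points (opoints t) (Node i s l r) =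
       join_children i s (delete_points (opoints tl) l) (delete_points (opoints tr) r)" by simp
    have u1: "1 \<le> leaves u" by (rule leaves_pos)
    \<comment> \<open>With both heights raised to \<open>K\<close>, the shares add up to
      \<open>leaves u\<close>. The level of the node supplies one more \<open>M * leaves u\<close>,
      which pays for its filters and the merge.\<close>
    have "M * oleaves tl * (kheight l + 1) + M * oleaves tr * (kheight r + 1)
        \<le> M * oleaves tl * (K + 1) + M * oleaves tr * (K + 1)"
      unfolding K_def by (intro add_mono mult_le_mono) auto
    also have "\<dots> = M * leaves u * (K + 1)" unfolding lv[symmetric] by (simp add: algebra_simps)
    finally have W1: "M * oleaves tl * (kheight l + 1) + M * oleaves tr * (kheight r + 1)
        \<le> M * leaves u * (K + 1)" .
    have "500 * leaves u \<le> M * leaves u" unfolding M_def by simp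
    moreover have "M * leaves u * (kheight (Node i s l r) + 1) = M * leaves u * (K + 1) + M * leaves u"
      by (simp add: K_def)
    ultimately have W: "M * oleaves tl * (kheight l + 1) + M * oleaves tr * (kheight r + 1)
        + 500 * leaves u \<le> M * leaves u * (kheight (Node i s l r) + 1)"
      using W1 by linarith
    have S1: "M * (H + 1) * (kheight l + 1) \<le> M * (H + 1) * (K + 1)"
      "M * (H + 1) * (kheight r + 1) \<le> M * (H + 1) * (K + 1)"
      unfolding K_def by (intro mult_le_mono; simp)+
    \<comment> \<open>Depth takes the maximum of the branches, so each child is bounded separately;
      the extra level pays for one filter, of depth at most \<open>80 * (H + 1)\<close>, and
      constant overhead.\<close>
    have "500 * (H + 1) \<le> M * (H + 1)" unfolding M_def by (intro mult_le_mono) simp_all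
    moreover have "M * (H + 1) * (kheight (Node i s l r) + 1) = M * (H + 1) * (K + 1) + M * (H + 1)"
      by (simp add: K_def)
    ultimately have S: "M * (H + 1) * (kheight l + 1) + 500 * (H + 1) \<le> M * (H + 1) * (kheight (Node i s l r) + 1)"
      "M * (H + 1) * (kheight r + 1) + 500 * (H + 1) \<le> M * (H + 1) * (kheight (Node i s l r) + 1)"
      using S1 by linarith+
    \<comment> \<open>Opaque names keep \<open>simp\<close> from multiplying out the products while
      it resolves \<open>max\<close>.\<close>
    define sl where "sl = M * (H + 1) * (kheight l + 1)"
    define sr where "sr = M * (H + 1) * (kheight r + 1)"
    define sn where "sn = M * (H + 1) * (kheight (Node i s l r) + 1)"
    show ?thesis
      unfolding delete_code_def Let_def eq enc_tree.simps enc_join_children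
      unfolding Some enc_btree_option.simps option_simps
      apply (rule eval_within_mono)
        apply (rule IH F within_merge_code within_rules | (rule within_if_True, (simp; fail))
            | (rule within_if_False, (simp; fail)))+
      subgoal using W u1 by linarith
      subgoal using S u(2) unfolding sl_def[symmetric] sr_def[symmetric] sn_def[symmetric]
        by (simp add: max_def)
      done
  qed
qed

theorem theorem2:
  "\<exists>P :: program. \<forall>d b :: nat. \<exists>C :: real.
     \<forall>(X :: point set) (T :: kdtree) (batch :: point list) (n :: nat) (B :: nat).
       median_kdtree d b X T \<and> card X = n \<and>
       set batch \<subseteq> space_dim d \<and> length batch = B \<and> B \<ge> 1 \<longrightarrow>
       (\<exists>w s :: nat.
          runs P (VPair (enc_tree T) (enc_batch batch))
                 (enc_tree_option (delete_points (set batch) T)) w s \<and>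
          real w \<le> C * (real B * lg n) \<and>
          real s \<le> C * (lg B * lg n))"
proof (rule exI[of _ kd_program], intro allI)
  fix d b :: nat
  define M where "M = (2 * (40 * d + 100) + 40) * (b + 1) + 500"
  show "\<exists>C :: real.
     \<forall>(X :: point set) (T :: kdtree) (batch :: point list) (n :: nat) (B :: nat).
       median_kdtree d b X T \<and> card X = n \<and>
       set batch \<subseteq> space_dim d \<and> length batch = B \<and> B \<ge> 1 \<longrightarrow>
       (\<exists>w s :: nat.
          runs kd_program (VPair (enc_tree T) (enc_batch batch))
                 (enc_tree_option (delete_points (set batch) T)) w s \<and>
          real w \<le> C * (real B * lg n) \<and>
          real s \<le> C * (lg B * lg n))"
  \<comment> \<open>The 9 is 3 * 3, from \<open>height_le_lg\<close> for the kd-tree and for the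
    batch tree; the 500 absorbs building the batch tree and the constants.\<close>
  proof (rule exI[of _ "9 * real M + 500"], intro allI impI, elim conjE)
    fix X T batch and n B :: nat
    assume T: "median_kdtree d b X T" and n: "card X = n"
      and batch: "set batch \<subseteq> space_dim d" "length batch = B" "B \<ge> 1"
    obtain t where t: "call_within build_code (VPair (enc_batch batch) (VPair (VNat 0) (VNat (length batch))))
        (enc_btree t) (100 * B - 50) (80 * (bheight t + 1))"
      and t': "bpoints t = set batch" "leaves t = B" "2 ^ bheight t < 2 * B"
      using build_within[of B 0 batch] batch by auto
    define h where "h = kheight T + 1"
    \<comment> \<open>This \<open>H\<close> already contains the \<open>+ 1\<close> that
      \<open>delete_within\<close> adds to its height bound, here \<open>bheight t\<close>.\<close>
    define H where "H = bheight t + 1"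
    have D: "call_within delete_code (VPair (enc_tree T) (enc_btree t))
       (enc_tree_option (delete_points (set batch) T)) (10 + M * B * h) (10 + M * H * h)"
      using delete_within[OF T, of "Some t" "bheight t"] batch t'
      unfolding M_def h_def H_def by simp
    have "call_within main_code (VPair (enc_tree T) (enc_batch batch))
       (enc_tree_option (delete_points (set batch) T))
       (100 + 100 * B + M * B * h) (100 + 80 * H + M * H * h)"
      unfolding main_code_def
      apply (rule eval_within_mono)
        apply (rule D t within_rules within_Len_batch)+
      using batch by (auto simp: H_def)
    then obtain w s where ev: "eval kd_program [VPair (enc_tree T) (enc_batch batch)] main_code
        (enc_tree_option (delete_points (set batch) T)) w s"
      and w: "w \<le> 100 + 100 * B + M * B * h" and s: "s \<le> 100 + 80 * H + M * H * h"
      unfolding eval_within_def by blast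
    have h: "real h \<le> 3 * lg n"
      using height_le_lg[OF median_kdtree_height[OF T]] n by (simp add: h_def)
    have H: "real H \<le> 3 * lg B" using height_le_lg[OF t'(3)] by (simp add: H_def)
    \<comment> \<open>These bounds let constants and single factors be absorbed into the products,
      also for \<open>n = 1\<close> or \<open>B = 1\<close>.\<close>
    have lg1: "1 \<le> lg n" "1 \<le> lg B" by (simp_all add: lg_def)
    have "real B * 1 \<le> real B * lg n" using lg1 by (intro mult_left_mono) auto
    moreover have "1 \<le> real B" using batch by simp
    moreover have "real M * (real B * real h) \<le> real M * (real B * (3 * lg n))"
      using h by (intro mult_left_mono) auto
    moreover have "real w \<le> 100 + 100 * real B + real M * (real B * real h)"
      using of_nat_mono[OF w, where 'a = real] by (simp add: mult.assoc)
    \<comment> \<open>The work uses only \<open>3 * M\<close>; nonnegativity fills up to the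
      \<open>9 * M\<close> that the depth requires.\<close>
    moreover have "0 \<le> real M * (real B * lg n)" using lg1 by simp
    ultimately have W: "real w \<le> (9 * real M + 500) * (real B * lg n)"
      unfolding distrib_right by linarith
    have "1 * 1 \<le> lg B * lg n" "lg B * 1 \<le> lg B * lg n"
      using lg1 by (intro mult_mono; simp)+
    moreover have "real M * (real H * real h) \<le> real M * ((3 * lg B) * (3 * lg n))"
      using h H lg1 by (intro mult_left_mono mult_mono) auto
    moreover have "real s \<le> 100 + 80 * real H + real M * (real H * real h)"
      using of_nat_mono[OF s, where 'a = real] by (simp add: mult.assoc)
    ultimately have S: "real s \<le> (9 * real M + 500) * (lg B * lg n)"
      using H unfolding distrib_right by linarith
    show "\<exists>w s. runs kd_program (VPair (enc_tree T) (enc_batch batch))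
                 (enc_tree_option (delete_points (set batch) T)) w s \<and>
          real w \<le> (9 * real M + 500) * (real B * lg n) \<and>
          real s \<le> (9 * real M + 500) * (lg B * lg n)"
      using ev W S by (intro exI[of _ w] exI[of _ s]) (simp add: runs_def kd_program_def)
  qed
qed

end
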